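(* Let $\Sigma$ be a signed graph on $n$ vertices with at least one edge. Then \[ \lambda_{\max}(L(\Sigma))\le \frac{s_1}{n-b(\Sigma)}+\sqrt{(s_1+s_2)-\frac{s_1+s_2+s_1^2}{n-b(\Sigma)}+\left(\frac{s_1}{n-b(\Sigma)}\right)^2}\,. \]
   Context: A signed graph $\Sigma=(\Gamma,\sigma)$ consists of a simple graph $\Gamma=(V,E)$, $V=\{v_1,\dots,v_n\}$, and a signature $\sigma:E\to\{+1,-1\}$. The adjacency matrix $A(\Sigma)$ has $(i,j)$ entry $\sigma(v_iv_j)$ if $v_i,v_j$ are adjacent and $0$ otherwise; $D(\Sigma)$ is the diagonal matrix of degrees $d_j=\deg(v_j)$; the Laplacian is $L(\Sigma)=D(\Sigma)-A(\Sigma)$ and $\lambda_{\max}(L(\Sigma))$ its largest eigenvalue. $s_p=\sum_{j=1}^n d_j^p$. The sign of a cycle is the product of the signs of its edges; a signed graph is balanced if all its cycles are positive; $b(\Sigma)$ is the number of connected components of $\Sigma$ that are balanced. *)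

theory Defs
  imports "Jordan_Normal_Form.Spectral_Radius"
begin

text \<open>The vertices \<open>v_1, \<dots>, v_n\<close> are the numbers \<open>0, \<dots>, n - 1\<close>, so that they serve directly as
  matrix indices. Only the values of \<open>\<sigma>\<close> on edges matter.\<close>

locale signed_graph =
  fixes n :: nat and E :: "nat set set" and \<sigma> :: "nat set \<Rightarrow> real"
  assumes simple_edges: "e \<in> E \<Longrightarrow> e \<subseteq> {0..<n} \<and> card e = 2"
    and signature: "e \<in> E \<Longrightarrow> \<sigma> e = 1 \<or> \<sigma> e = -1"

definition vertex_degree :: "nat set set \<Rightarrow> nat \<Rightarrow> nat" where
  "vertex_degree E v = card {e \<in> E. v \<in> e}"

definition deg_power_sum :: "nat \<Rightarrow> nat set set \<Rightarrow> nat \<Rightarrow> real" where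
  "deg_power_sum n E p = (\<Sum>v<n. real (vertex_degree E v) ^ p)"

definition adjacency_matrix :: "nat \<Rightarrow> nat set set \<Rightarrow> (nat set \<Rightarrow> real) \<Rightarrow> real mat" where
  "adjacency_matrix n E \<sigma> = mat n n (\<lambda>(i, j). if {i, j} \<in> E then \<sigma> {i, j} else 0)"

definition degree_matrix :: "nat \<Rightarrow> nat set set \<Rightarrow> real mat" where
  "degree_matrix n E = mat_diag n (\<lambda>v. real (vertex_degree E v))"

definition laplacian :: "nat \<Rightarrow> nat set set \<Rightarrow> (nat set \<Rightarrow> real) \<Rightarrow> real mat" where
  "laplacian n E \<sigma> = degree_matrix n E - adjacency_matrix n E \<sigma>"

text \<open>Largest real eigenvalue. The Laplacian of a signed graph is a real symmetric matrix, so all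
  its eigenvalues are real; its spectrum is finite, and non-empty if \<open>n > 0\<close>.\<close>

definition lambda_max :: "real mat \<Rightarrow> real" where
  "lambda_max M = Max (spectrum M)"

text \<open>A cycle is given by the list of its vertices; \<open>cycle_edges [w_1, \<dots>, w_k]\<close> is
  \<open>[{w_1, w_2}, \<dots>, {w_(k-1), w_k}, {w_k, w_1}]\<close>.\<close>

definition cycle_edges :: "nat list \<Rightarrow> nat set list" where
  "cycle_edges ws = map2 (\<lambda>u v. {u, v}) ws (rotate1 ws)"

definition is_cycle :: "nat set set \<Rightarrow> nat list \<Rightarrow> bool" where
  "is_cycle E ws \<longleftrightarrow> length ws \<ge> 3 \<and> distinct ws \<and> set (cycle_edges ws) \<subseteq> E"

definition cycle_sign :: "(nat set \<Rightarrow> real) \<Rightarrow> nat list \<Rightarrow> real" where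
  "cycle_sign \<sigma> ws = prod_list (map \<sigma> (cycle_edges ws))"

definition balanced :: "nat set set \<Rightarrow> (nat set \<Rightarrow> real) \<Rightarrow> bool" where
  "balanced E \<sigma> \<longleftrightarrow> (\<forall>ws. is_cycle E ws \<longrightarrow> cycle_sign \<sigma> ws = 1)"

definition connected_rel :: "nat \<Rightarrow> nat set set \<Rightarrow> nat rel" where
  "connected_rel n E =
     {(u, v). u < n \<and> v < n \<and> (u, v) \<in> {(x, y). {x, y} \<in> E}\<^sup>*}"

text \<open>Vertex sets of the connected components; isolated vertices are components of their own.\<close>

definition components :: "nat \<Rightarrow> nat set set \<Rightarrow> nat set set" where
  "components n E = {0..<n} // connected_rel n E"

definition num_balanced_components :: "nat \<Rightarrow> nat set set \<Rightarrow> (nat set \<Rightarrow> real) \<Rightarrow> nat" where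
  "num_balanced_components n E \<sigma> =
     card {C \<in> components n E. balanced {e \<in> E. e \<subseteq> C} \<sigma>}"

end

theory Submission
  imports Defs "HOL-Analysis.Convex"
begin

text \<open>On a balanced component the signature has the form \<open>\<sigma> {u, v} = \<theta> u * \<theta> v\<close> with \<open>\<theta> = \<plusminus>1\<close>, the sign
  of any walk from a root, and \<open>\<theta>\<close> extended by zero lies in the kernel of the Laplacian \<open>L\<close>. The
  normalised vectors of this kind are orthonormal, and orthogonal to a unit eigenvector \<open>x\<close> with
  eigenvalue \<open>\<mu> \<noteq> 0\<close>. Let \<open>M\<close> be the orthogonal projection onto the complement of all of them, of rank
  \<open>r - 1\<close> where \<open>r = n - b\<close>. Cauchy--Schwarz for the Frobenius inner product of \<open>M\<close> with
  \<open>L - \<mu> x x\<^sup>T\<close> gives \<open>(s\<^sub>1 - \<mu>)\<^sup>2 \<le> (r - 1) (s\<^sub>1 + s\<^sub>2 - \<mu>\<^sup>2)\<close>, because \<open>L\<close> has trace \<open>s\<^sub>1\<close> and squared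
  Frobenius norm \<open>s\<^sub>1 + s\<^sub>2\<close>; solving for \<open>\<mu>\<close> yields the bound, without the spectral theorem.\<close>

subsection \<open>Trace, Frobenius norm and eigenvalues\<close>

lemma frobenius_trace_bound:
  fixes B :: "nat \<Rightarrow> nat \<Rightarrow> real" and w :: "'k \<Rightarrow> nat \<Rightarrow> real"
  assumes K: "finite K"
    and orth: "\<And>k l. k \<in> K \<Longrightarrow> l \<in> K \<Longrightarrow> (\<Sum>i<n. w k i * w l i) = (if k = l then 1 else 0)"
  shows "((\<Sum>i<n. B i i) - (\<Sum>k\<in>K. \<Sum>i<n. \<Sum>j<n. w k i * B i j * w k j))\<^sup>2
           \<le> (real n - real (card K)) * (\<Sum>i<n. \<Sum>j<n. (B i j)\<^sup>2)"
proof -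
  define P where "P i j = (\<Sum>k\<in>K. w k i * w k j)" for i j
  \<comment> \<open>The orthogonal projection onto the complement of the span of the family, of squared Frobenius
    norm \<open>n - card K\<close>; the claim is Cauchy--Schwarz for \<open>M\<close> and \<open>B\<close>.\<close>
  define M where "M i j = (if i = j then 1 else 0) - P i j" for i j
  have dP: "(\<Sum>i<n. P i i) = real (card K)"
    unfolding P_def by (subst sum.swap) (simp add: orth)
  \<comment> \<open>The diagonal of \<open>P * P = P\<close>, read off as squared row norms because
    \<open>P\<close> is symmetric.\<close>
  have PP: "(\<Sum>j<n. P i j * P i j) = P i i" if "i < n" for i
  proof -
    have "(\<Sum>j<n. P i j * P i j) = (\<Sum>j<n. \<Sum>k\<in>K. \<Sum>l\<in>K. (w k i * w l i) * (w k j * w l j))"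
      unfolding P_def by (simp add: sum_product mult_ac)
    also have "\<dots> = (\<Sum>k\<in>K. \<Sum>l\<in>K. (w k i * w l i) * (\<Sum>j<n. w k j * w l j))"
      by (subst sum.swap, rule sum.cong[OF refl], subst sum.swap) (simp add: sum_distrib_left)
    also have "\<dots> = (\<Sum>k\<in>K. \<Sum>l\<in>K. if k = l then w k i * w l i else 0)"
      by (intro sum.cong refl) (simp add: orth)
    also have "\<dots> = P i i"
      using K by (simp add: P_def)
    finally show ?thesis .
  qed
  have "(\<Sum>i<n. \<Sum>j<n. (M i j)\<^sup>2) = (\<Sum>i<n. 1 - P i i)"
  proof (rule sum.cong[OF refl])
    fix i assume i: "i \<in> {..<n}"
    have "(\<Sum>j<n. (M i j)\<^sup>2) = (\<Sum>j<n. (if i = j then 1 - 2 * P i j else 0) + P i j * P i j)"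
      by (intro sum.cong refl) (auto simp: M_def power2_eq_square algebra_simps)
    also have "\<dots> = 1 - P i i"
      using i by (simp add: sum.distrib PP)
    finally show "(\<Sum>j<n. (M i j)\<^sup>2) = 1 - P i i" .
  qed
  also have "\<dots> = real n - real (card K)"
    by (simp add: sum_subtractf dP)
  finally have MM: "(\<Sum>i<n. \<Sum>j<n. (M i j)\<^sup>2) = real n - real (card K)" .
  have PB: "(\<Sum>i<n. \<Sum>j<n. P i j * B i j) = (\<Sum>k\<in>K. \<Sum>i<n. \<Sum>j<n. w k i * B i j * w k j)"
  proof -
    have "(\<Sum>i<n. \<Sum>j<n. P i j * B i j) = (\<Sum>i<n. \<Sum>j<n. \<Sum>k\<in>K. w k i * B i j * w k j)"
      unfolding P_def by (simp add: sum_distrib_left mult_ac)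
    also have "\<dots> = (\<Sum>i<n. \<Sum>k\<in>K. \<Sum>j<n. w k i * B i j * w k j)"
      by (rule sum.cong[OF refl], rule sum.swap)
    also have "\<dots> = (\<Sum>k\<in>K. \<Sum>i<n. \<Sum>j<n. w k i * B i j * w k j)"
      by (rule sum.swap)
    finally show ?thesis .
  qed
  have "(\<Sum>i<n. \<Sum>j<n. M i j * B i j)
      = (\<Sum>i<n. \<Sum>j<n. (if i = j then B i j else 0) - P i j * B i j)"
    by (intro sum.cong refl) (auto simp: M_def algebra_simps)
  also have "\<dots> = (\<Sum>i<n. B i i) - (\<Sum>k\<in>K. \<Sum>i<n. \<Sum>j<n. w k i * B i j * w k j)"
    by (simp add: sum_subtractf PB)
  finally have MB: "(\<Sum>i<n. \<Sum>j<n. M i j * B i j)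
      = (\<Sum>i<n. B i i) - (\<Sum>k\<in>K. \<Sum>i<n. \<Sum>j<n. w k i * B i j * w k j)" .
  have "(\<Sum>p\<in>{..<n}\<times>{..<n}. case_prod M p * case_prod B p)\<^sup>2
     \<le> (\<Sum>p\<in>{..<n}\<times>{..<n}. (case_prod M p)\<^sup>2) * (\<Sum>p\<in>{..<n}\<times>{..<n}. (case_prod B p)\<^sup>2)"
    by (rule Cauchy_Schwarz_ineq_sum)
  then show ?thesis
    by (simp add: sum.cartesian_product' MM MB)
qed

text \<open>The projection bound is used twice. With the given family alone it yields
  \<open>t\<^sup>2 \<le> r * q\<close>, hence \<open>r > 0\<close> and a nonnegative radicand. With
  a unit eigenvector adjoined and \<open>B\<close> deflated it yields a quadratic inequality for
  \<open>\<mu>\<close>. The second use needs \<open>\<mu> \<noteq> 0\<close>, since a null vector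
  may lie in the span of the family.\<close>

lemma eigenvalue_le_trace_frobenius:
  fixes B :: "nat \<Rightarrow> nat \<Rightarrow> real" and w :: "'k \<Rightarrow> nat \<Rightarrow> real"
  assumes K: "finite K"
    and orth: "\<And>k l. k \<in> K \<Longrightarrow> l \<in> K \<Longrightarrow> (\<Sum>i<n. w k i * w l i) = (if k = l then 1 else 0)"
    and sym: "\<And>i j. i < n \<Longrightarrow> j < n \<Longrightarrow> B i j = B j i"
    and ker: "\<And>k i. k \<in> K \<Longrightarrow> i < n \<Longrightarrow> (\<Sum>j<n. B i j * w k j) = 0"
    and eig: "\<And>i. i < n \<Longrightarrow> (\<Sum>j<n. B i j * x j) = \<mu> * x i"
    and nz: "\<exists>i<n. x i \<noteq> 0"
    and t: "(\<Sum>i<n. B i i) = t" "t > 0"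
    and q: "(\<Sum>i<n. \<Sum>j<n. (B i j)\<^sup>2) = q"
    and r: "r = real n - real (card K)"
  shows "\<mu> \<le> t / r + sqrt (q - (q + t\<^sup>2) / r + (t / r)\<^sup>2)"
proof -
  have quad0: "(\<Sum>i<n. \<Sum>j<n. w k i * B i j * w k j) = 0" if "k \<in> K" for k
  proof -
    have "(\<Sum>i<n. \<Sum>j<n. w k i * B i j * w k j) = (\<Sum>i<n. w k i * (\<Sum>j<n. B i j * w k j))"
      by (simp add: sum_distrib_left mult_ac)
    then show ?thesis by (simp add: ker that)
  qed
  \<comment> \<open>As \<open>B\<close> vanishes on the family, the whole trace is carried by its
    complement. Together with \<open>t > 0\<close> this excludes \<open>r = 0\<close>, so the
    divisions by \<open>r\<close> are genuine.\<close>
  have tq: "t\<^sup>2 \<le> r * q"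
    using frobenius_trace_bound[OF K orth, of B] by (simp add: quad0 t q r)
  have "q \<ge> 0"
    unfolding q[symmetric] by (intro sum_nonneg) simp
  moreover have "0 < r * q"
    using tq zero_less_power[OF \<open>t > 0\<close>, of 2] by linarith
  ultimately have "r > 0"
    by (simp add: zero_less_mult_iff)
  \<comment> \<open>A positive difference of two natural numbers is at least 1.\<close>
  then have r1: "r \<ge> 1"
    unfolding r by (simp add: less_imp_Suc_add flip: of_nat_diff)
  have arg: "q - (q + t\<^sup>2) / r + (t / r)\<^sup>2 = (r - 1) * (r * q - t\<^sup>2) / r\<^sup>2"
    using \<open>r > 0\<close> by (simp add: field_simps power2_eq_square)
  show ?thesis
  proof (cases "\<mu> = 0")
    case True
    \<comment> \<open>The sign matters: \<open>sqrt\<close> is an odd function on the reals,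
      negative on negative arguments.\<close>
    have "0 \<le> (r - 1) * (r * q - t\<^sup>2) / r\<^sup>2"
      using r1 tq by simp
    then show ?thesis
      unfolding arg True using \<open>t > 0\<close> \<open>r > 0\<close> by simp
  next
    case False
    define N where "N = sqrt (\<Sum>i<n. (x i)\<^sup>2)"
    obtain i0 where i0: "i0 < n" "x i0 \<noteq> 0" using nz by blast
    have pos: "(\<Sum>i<n. (x i)\<^sup>2) > 0"
      by (rule sum_pos2[of _ i0]) (use i0 in auto)
    have N: "N > 0" "N\<^sup>2 = (\<Sum>i<n. (x i)\<^sup>2)"
      using pos by (auto simp: N_def)
    define y where "y i = x i / N" for i
    have yy: "(\<Sum>i<n. y i * y i) = 1"
    proof -
      have "(\<Sum>i<n. y i * y i) = (\<Sum>i<n. (x i)\<^sup>2) / N\<^sup>2"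
        by (simp add: y_def power2_eq_square sum_divide_distrib)
      then show ?thesis using pos by (simp add: N(2))
    qed
    have By: "(\<Sum>j<n. B i j * y j) = \<mu> * y i" if "i < n" for i
      using eig[OF that] by (simp add: y_def sum_divide_distrib[symmetric])
    \<comment> \<open>Symmetry moves \<open>B\<close> from \<open>y\<close> onto \<open>w k\<close>,
      where it vanishes; then the factor \<open>\<mu>\<close> is cancelled.\<close>
    have wy: "(\<Sum>i<n. w k i * y i) = 0" if "k \<in> K" for k
    proof -
      have "\<mu> * (\<Sum>i<n. w k i * y i) = (\<Sum>i<n. w k i * (\<mu> * y i))"
        by (simp add: sum_distrib_left mult_ac)
      also have "\<dots> = (\<Sum>i<n. w k i * (\<Sum>j<n. B i j * y j))"
        by (intro sum.cong refl) (simp add: By)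
      also have "\<dots> = (\<Sum>i<n. \<Sum>j<n. B j i * w k i * y j)"
        unfolding sum_distrib_left by (intro sum.cong refl) (simp add: sym mult_ac)
      also have "\<dots> = (\<Sum>j<n. (\<Sum>i<n. B j i * w k i) * y j)"
        by (subst sum.swap) (simp add: sum_distrib_right)
      also have "\<dots> = 0" by (simp add: ker that)
      finally show ?thesis using False by simp
    qed
    have yw: "(\<Sum>i<n. y i * w k i) = 0" if "k \<in> K" for k
      using wy[OF that] by (simp add: mult.commute)
    \<comment> \<open>The option type supplies a fresh index \<open>None\<close> for the
      eigenvector, whatever the index type of the family.\<close>
    define K' where "K' = insert None (Some ` K)"
    define w' where "w' = case_option y w"
    \<comment> \<open>Deflation: subtracting the rank-one part makes the matrix annihilate
      \<open>y\<close> while it still annihilates every \<open>w k\<close>.\<close>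
    define B' where "B' i j = B i j - \<mu> * (y i * y j)" for i j
    have K': "finite K'" "card K' = Suc (card K)"
      using K by (auto simp: K'_def card_image)
    have orth': "(\<Sum>i<n. w' k i * w' l i) = (if k = l then 1 else 0)" if "k \<in> K'" "l \<in> K'" for k l
      using that orth wy yw yy unfolding K'_def w'_def by (cases k; cases l) auto
    have B'w: "(\<Sum>j<n. B' i j * w' k j) = 0" if "i < n" "k \<in> K'" for i k
    proof -
      have "(\<Sum>j<n. B' i j * w' k j) = (\<Sum>j<n. B i j * w' k j) - \<mu> * y i * (\<Sum>j<n. y j * w' k j)"
        by (simp add: B'_def sum_subtractf sum_distrib_left algebra_simps)
      also have "\<dots> = 0"
        using that By ker yy yw by (auto simp: K'_def w'_def)
      finally show ?thesis .
    qed
    have quad: "(\<Sum>i<n. \<Sum>j<n. w' k i * B' i j * w' k j) = 0" if "k \<in> K'" for k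
    proof -
      have "(\<Sum>i<n. \<Sum>j<n. w' k i * B' i j * w' k j) = (\<Sum>i<n. w' k i * (\<Sum>j<n. B' i j * w' k j))"
        by (simp add: sum_distrib_left mult_ac)
      then show ?thesis by (simp add: B'w that)
    qed
    have tr': "(\<Sum>i<n. B' i i) = t - \<mu>"
      by (simp add: B'_def sum_subtractf t sum_distrib_left[symmetric] yy)
    \<comment> \<open>By the eigenvector equation the cross term is
      \<open>- 2 * \<mu>\<^sup>2 * (y i)\<^sup>2\<close>, of which the square of the rank-one part
      restores half.\<close>
    have row: "(\<Sum>j<n. (B' i j)\<^sup>2) = (\<Sum>j<n. (B i j)\<^sup>2) - \<mu>\<^sup>2 * (y i * y i)" if "i < n" for i
    proof -
      have "(\<Sum>j<n. (B' i j)\<^sup>2)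
          = (\<Sum>j<n. (B i j)\<^sup>2 - (2 * \<mu> * y i) * (B i j * y j) + (\<mu>\<^sup>2 * (y i * y i)) * (y j * y j))"
        by (intro sum.cong refl) (simp add: B'_def power2_eq_square algebra_simps)
      also have "\<dots> = (\<Sum>j<n. (B i j)\<^sup>2) - (2 * \<mu> * y i) * (\<mu> * y i) + \<mu>\<^sup>2 * (y i * y i)"
        by (simp only: sum.distrib sum_subtractf sum_distrib_left[symmetric] By[OF that] yy mult_1_right)
      finally show ?thesis by (simp add: power2_eq_square)
    qed
    have q': "(\<Sum>i<n. \<Sum>j<n. (B' i j)\<^sup>2) = q - \<mu>\<^sup>2"
      by (simp add: row sum_subtractf q yy flip: sum_distrib_left)
    have "(t - \<mu>)\<^sup>2 \<le> (real n - real (card K')) * (q - \<mu>\<^sup>2)"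
      using frobenius_trace_bound[OF K'(1) orth', of B'] by (simp add: quad tr' q')
    also have "real n - real (card K') = r - 1"
      by (simp add: r K'(2))
    finally have "(t - \<mu>)\<^sup>2 \<le> (r - 1) * (q - \<mu>\<^sup>2)" .
    then have "(r * \<mu> - t)\<^sup>2 \<le> (r - 1) * (r * q - t\<^sup>2)"
    proof -
      assume a: "(t - \<mu>)\<^sup>2 \<le> (r - 1) * (q - \<mu>\<^sup>2)"
      \<comment> \<open>Multiplying the quadratic inequality by \<open>r\<close> completes the
        square in \<open>\<mu>\<close>.\<close>
      have "(r - 1) * (r * q - t\<^sup>2) - (r * \<mu> - t)\<^sup>2 = r * ((r - 1) * (q - \<mu>\<^sup>2) - (t - \<mu>)\<^sup>2)"
        by (simp add: power2_eq_square algebra_simps)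
      moreover have "r * ((r - 1) * (q - \<mu>\<^sup>2) - (t - \<mu>)\<^sup>2) \<ge> 0"
        using a \<open>r > 0\<close> by simp
      ultimately show ?thesis by linarith
    qed
    then have "(r * \<mu> - t)\<^sup>2 / r\<^sup>2 \<le> (r - 1) * (r * q - t\<^sup>2) / r\<^sup>2"
      by (rule divide_right_mono) simp
    moreover have "\<mu> - t / r = (r * \<mu> - t) / r"
      using \<open>r > 0\<close> by (simp add: diff_divide_distrib)
    ultimately have "(\<mu> - t / r)\<^sup>2 \<le> (r - 1) * (r * q - t\<^sup>2) / r\<^sup>2"
      by (simp only: power_divide)
    then have "\<mu> - t / r \<le> sqrt ((r - 1) * (r * q - t\<^sup>2) / r\<^sup>2)"
      by (rule real_le_rsqrt)
    then show ?thesis unfolding arg by simp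
  qed
qed

lemma symmetric_spectrum_nonempty:
  fixes A :: "real mat"
  assumes A: "A \<in> carrier_mat n n" and n: "n > 0"
    and sym: "\<And>i j. i < n \<Longrightarrow> j < n \<Longrightarrow> A $$ (i, j) = A $$ (j, i)"
  shows "spectrum A \<noteq> {}"
proof -
  \<comment> \<open>A complex eigenvalue exists, and it is real because \<open>v\<^sup>* A v\<close> is.\<close>
  define A' :: "complex mat" where "A' = map_mat of_real A"
  have A': "A' \<in> carrier_mat n n" using A by (simp add: A'_def)
  obtain \<mu> v where v: "v \<in> carrier_vec n" "v \<noteq> 0\<^sub>v n" "A' *\<^sub>v v = \<mu> \<cdot>\<^sub>v v" and ev: "eigenvalue A' \<mu>"
    using spectrum_non_empty[OF A' n] A'
    by (auto simp: spectrum_def eigenvalue_def eigenvector_def)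
  have Av: "(\<Sum>j<n. of_real (A $$ (i, j)) * v $ j) = \<mu> * v $ i" if "i < n" for i
  proof -
    have "(A' *\<^sub>v v) $ i = (\<Sum>j<n. of_real (A $$ (i, j)) * v $ j)"
      using that A v(1) by (simp add: A'_def scalar_prod_def atLeast0LessThan)
    then show ?thesis using that v by simp
  qed
  define S where "S = (\<Sum>i<n. \<Sum>j<n. cnj (v $ i) * of_real (A $$ (i, j)) * v $ j)"
  define N where "N = (\<Sum>i<n. (cmod (v $ i))\<^sup>2)"
  have "S = (\<Sum>i<n. cnj (v $ i) * (\<Sum>j<n. of_real (A $$ (i, j)) * v $ j))"
    by (simp add: S_def sum_distrib_left mult_ac)
  also have "\<dots> = (\<Sum>i<n. \<mu> * of_real ((cmod (v $ i))\<^sup>2))"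
    by (intro sum.cong refl) (simp only: lessThan_iff Av complex_norm_square mult.left_commute mult.commute[of "cnj _"])
  finally have S: "S = \<mu> * of_real N"
    by (simp add: N_def sum_distrib_left)
  \<comment> \<open>Conjugation exchanges the roles of the two indices, since the entries are real
    and symmetric.\<close>
  have "cnj S = (\<Sum>i<n. \<Sum>j<n. cnj (v $ j) * of_real (A $$ (j, i)) * v $ i)"
    unfolding S_def cnj_sum by (intro sum.cong refl) (simp add: sym mult_ac)
  also have "\<dots> = S" unfolding S_def by (rule sum.swap)
  finally have "cnj S = S" .
  obtain i where "i < n" "v $ i \<noteq> 0"
    using v(1,2) by (metis carrier_vecD eq_vecI index_zero_vec(1) index_zero_vec(2))
  then have "N > 0"
    unfolding N_def by (intro sum_pos2[of _ i]) auto
  with \<open>cnj S = S\<close> have "cnj \<mu> = \<mu>" by (simp add: S)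
  then obtain a where a: "\<mu> = of_real a"
    by (metis Reals_cnj_iff Reals_cases)
  \<comment> \<open>The characteristic polynomial commutes with the embedding of the reals, so a
    real root descends to \<open>A\<close> without a real eigenvector being constructed.\<close>
  have "poly (char_poly A') \<mu> = 0"
    using ev eigenvalue_root_char_poly[OF A'] by blast
  then have "poly (char_poly A) a = 0"
    unfolding A'_def a of_real_hom.char_poly_hom[OF A] of_real_hom.poly_map_poly by simp
  then show ?thesis
    using eigenvalue_root_char_poly[OF A] by (auto simp: spectrum_def)
qed

subsection \<open>Balance and switching\<close>

text \<open>Walks, with repeated vertices allowed, because concatenating walks and cutting out
  closed parts leaves the class of paths and cycles.\<close>

fun path_edges :: "'a list \<Rightarrow> 'a set list" where
  "path_edges (u # v # ws) = {u, v} # path_edges (v # ws)"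
| "path_edges _ = []"

definition path_sign :: "('a set \<Rightarrow> real) \<Rightarrow> 'a list \<Rightarrow> real" where
  "path_sign \<sigma> ws = prod_list (map \<sigma> (path_edges ws))"

lemma path_edges_append: "path_edges (us @ v # ws) = path_edges (us @ [v]) @ path_edges (v # ws)"
  by (induction us rule: path_edges.induct) (cases ws; simp)+

lemma path_edges_rev: "path_edges (rev ws) = rev (path_edges ws)"
proof (induction ws rule: path_edges.induct)
  case (1 u v ws)
  have "path_edges (rev (u # v # ws)) = path_edges (rev (v # ws)) @ path_edges [v, u]"
    using path_edges_append[of "rev ws" v "[u]"] by simp
  with 1 show ?case by (simp add: insert_commute)
qed simp_all

lemma path_sign_rev: "path_sign \<sigma> (rev ws) = path_sign \<sigma> ws"
  by (simp add: path_sign_def path_edges_rev rev_map[symmetric])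

text \<open>Reads a cycle as a closed walk whose start is repeated at the end, so that balance can
  speak about walks.\<close>

lemma cycle_edges_eq_path_edges: "cycle_edges (w # ws) = path_edges (w # ws @ [w])"
proof -
  \<comment> \<open>The start \<open>u\<close> is separated from the endpoint \<open>w\<close>,
    because the induction moves only the start.\<close>
  have "map2 (\<lambda>u v. {u, v}) (u # us) (us @ [w]) = path_edges (u # us @ [w])" for u us
    by (induction us arbitrary: u) auto
  then show ?thesis by (simp add: cycle_edges_def)
qed

text \<open>Strong induction on length. A closed walk that repeats no vertex besides its endpoint is
  a single vertex, an edge traversed back and forth with sign a square, or a cycle covered by
  balance.\<close>

lemma balanced_closed_walk:
  assumes bal: "balanced E \<sigma>"
    and simple: "\<And>e. e \<in> E \<Longrightarrow> card e = 2"
    and sgn: "\<And>e. e \<in> E \<Longrightarrow> \<sigma> e = 1 \<or> \<sigma> e = -1"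
  shows "set (path_edges p) \<subseteq> E \<Longrightarrow> p \<noteq> [] \<Longrightarrow> hd p = last p \<Longrightarrow> path_sign \<sigma> p = 1"
proof (induction p rule: length_induct)
  case (1 p)
  consider w where "p = [w]" | w ws where "p = w # ws @ [w]"
    using 1(3,4) by (cases p; cases "tl p" rule: rev_cases) auto
  then show ?case
  proof cases
    case 1
    then show ?thesis by (simp add: path_sign_def)
  next
    case (2 w ws)
    show ?thesis
    proof (cases "distinct (w # ws)")
      case True
      consider "ws = []" | u where "ws = [u]" | "length (w # ws) \<ge> 3"
        by (cases ws; cases "tl ws") auto
      then show ?thesis
      proof cases
        case 1
        \<comment> \<open>The walk \<open>[w, w]\<close> would need a loop, which is a singleton and
          not a two-element edge.\<close>
        then have "{w} \<in> E" using "1.prems"(1) 2 by simp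
        then show ?thesis using simple[of "{w}"] by simp
      next
        case (2 u)
        then have "{w, u} \<in> E" using "1.prems"(1) \<open>p = w # ws @ [w]\<close> by simp
        then show ?thesis
          using sgn[of "{w, u}"] 2 \<open>p = w # ws @ [w]\<close>
          by (auto simp: path_sign_def insert_commute)
      next
        case 3
        have "is_cycle E (w # ws)"
          using 3 True "1.prems"(1) 2 by (simp only: is_cycle_def cycle_edges_eq_path_edges)
        then have "cycle_sign \<sigma> (w # ws) = 1" using bal by (simp add: balanced_def)
        then show ?thesis by (simp only: cycle_sign_def path_sign_def cycle_edges_eq_path_edges 2)
      qed
    next
      \<comment> \<open>A repeated vertex splits the closed walk into two shorter ones.\<close>
      case False
      then obtain xs ys zs y where d: "w # ws = xs @ [y] @ ys @ [y] @ zs"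
        using not_distinct_decomp by blast
      have p: "p = xs @ y # ys @ y # (zs @ [w])"
        using 2 d by (metis append.assoc append_Cons append_Nil)
      have e: "path_edges p = path_edges (xs @ [y]) @ path_edges (y # ys @ [y]) @ path_edges (y # zs @ [w])"
        unfolding p using path_edges_append[of xs y "ys @ y # zs @ [w]"]
          path_edges_append[of "y # ys" y "zs @ [w]"] by simp
      have s: "path_sign \<sigma> p = path_sign \<sigma> (xs @ y # zs @ [w]) * path_sign \<sigma> (y # ys @ [y])"
        unfolding path_sign_def e using path_edges_append[of xs y "zs @ [w]"] by simp
      have "path_sign \<sigma> (y # ys @ [y]) = 1"
        by (rule "1.IH"[rule_format]) (use "1.prems"(1) e in \<open>auto simp: p\<close>)
      moreover have "path_sign \<sigma> (xs @ y # zs @ [w]) = 1"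
      proof (rule "1.IH"[rule_format])
        show "set (path_edges (xs @ y # zs @ [w])) \<subseteq> E"
          using "1.prems"(1) e path_edges_append[of xs y "zs @ [w]"] by auto
        show "hd (xs @ y # zs @ [w]) = last (xs @ y # zs @ [w])"
          using d by (cases xs) auto
      qed (auto simp: p)
      ultimately show ?thesis using s by simp
    qed
  qed
qed

lemma rtrancl_path:
  assumes "(u, v) \<in> {(x, y). {x, y} \<in> E}\<^sup>*"
  shows "\<exists>p. p \<noteq> [] \<and> hd p = u \<and> last p = v \<and> set (path_edges p) \<subseteq> E"
  using assms
proof (induction rule: rtrancl_induct)
  case base
  show ?case by (rule exI[of _ "[u]"]) simp
next
  case (step y z)
  then obtain p where p: "p \<noteq> []" "hd p = u" "last p = y" "set (path_edges p) \<subseteq> E" by blast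
  then have "p @ [z] = butlast p @ y # [z]" "p = butlast p @ [y]"
    by (metis append.assoc append_Cons append_Nil append_butlast_last_id)+
  then have "path_edges (p @ [z]) = path_edges p @ [{y, z}]"
    by (metis path_edges_append path_edges.simps(1,3))
  then show ?case
    using p step.hyps(2) by (intro exI[of _ "p @ [z]"]) auto
qed

text \<open>Fix one walk from \<open>r\<close> to each vertex and let \<open>\<theta>\<close> be its
  sign. Going out to \<open>u\<close>, across the edge to \<open>v\<close> and back to
  \<open>r\<close> is a closed walk, so its sign is 1; values \<plusminus>1 are their own
  inverses.\<close>

lemma balanced_switching:
  assumes bal: "balanced E \<sigma>"
    and simple: "\<And>e. e \<in> E \<Longrightarrow> card e = 2"
    and sgn: "\<And>e. e \<in> E \<Longrightarrow> \<sigma> e = 1 \<or> \<sigma> e = -1"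
    and conn: "\<And>v. v \<in> C \<Longrightarrow> (r, v) \<in> {(x, y). {x, y} \<in> E}\<^sup>*"
  shows "\<exists>\<theta>. (\<forall>v\<in>C. \<theta> v = 1 \<or> \<theta> v = -1)
    \<and> (\<forall>u\<in>C. \<forall>v\<in>C. {u, v} \<in> E \<longrightarrow> \<sigma> {u, v} = \<theta> u * \<theta> v)"
proof -
  obtain p where p: "\<And>v. v \<in> C \<Longrightarrow> p v \<noteq> [] \<and> hd (p v) = r \<and> last (p v) = v \<and> set (path_edges (p v)) \<subseteq> E"
    using rtrancl_path[OF conn] by metis
  define \<theta> where "\<theta> v = path_sign \<sigma> (p v)" for v
  have pm: "\<theta> v = 1 \<or> \<theta> v = -1" if "v \<in> C" for v
  proof -
    have "set es \<subseteq> E \<Longrightarrow> prod_list (map \<sigma> es) = 1 \<or> prod_list (map \<sigma> es) = -1" for es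
      by (induction es) (use sgn in fastforce)+
    then show ?thesis using p[OF that] by (simp add: \<theta>_def path_sign_def)
  qed
  have "\<sigma> {u, v} = \<theta> u * \<theta> v" if "u \<in> C" "v \<in> C" and e: "{u, v} \<in> E" for u v
  proof -
    obtain pu where pu: "p u = pu @ [u]"
      using p[OF \<open>u \<in> C\<close>] by (metis append_butlast_last_id)
    obtain pv where pv: "rev (p v) = v # pv"
      using p[OF \<open>v \<in> C\<close>] by (metis hd_rev list.collapse rev_is_Nil_conv)
    let ?c = "pu @ u # v # pv"
    have ce: "path_edges ?c = path_edges (p u) @ {u, v} # path_edges (rev (p v))"
      by (subst path_edges_append) (simp add: pu pv)
    have "path_sign \<sigma> ?c = 1"
    proof (rule balanced_closed_walk[OF bal simple sgn])
      show "set (path_edges ?c) \<subseteq> E"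
        using ce p that by (auto simp: path_edges_rev)
      have "hd ?c = r" using p[OF \<open>u \<in> C\<close>] pu by (cases pu) auto
      moreover have "last ?c = r" using p[OF \<open>v \<in> C\<close>] pv by (metis last_ConsR last_appendR last_rev list.distinct(1))
      ultimately show "hd ?c = last ?c" by simp
    qed auto
    then have "\<theta> u * \<sigma> {u, v} * \<theta> v = 1"
      using ce path_sign_rev[of \<sigma> "p v"] by (simp add: path_sign_def \<theta>_def)
    then show ?thesis using pm[OF \<open>u \<in> C\<close>] pm[OF \<open>v \<in> C\<close>] by auto
  qed
  then show ?thesis using pm by blast
qed

subsection \<open>The Laplacian of a signed graph\<close>

context signed_graph
begin

lemma edge_vertices: "{u, v} \<in> E \<Longrightarrow> u < n \<and> v < n \<and> u \<noteq> v"
  using simple_edges[of "{u, v}"] by auto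

text \<open>An edge at \<open>v\<close> is determined by its other endpoint. The indicator sum is
  the form that computations along a row of the Laplacian need.\<close>

lemma vertex_degree_eq_sum: "real (vertex_degree E v) = (\<Sum>j<n. if {v, j} \<in> E then 1 else 0)"
proof -
  have "bij_betw (\<lambda>j. {v, j}) {j \<in> {..<n}. {v, j} \<in> E} {e \<in> E. v \<in> e}"
  proof (rule bij_betw_imageI)
    show "inj_on (\<lambda>j. {v, j}) {j \<in> {..<n}. {v, j} \<in> E}"
      by (auto simp: inj_on_def doubleton_eq_iff)
    have "\<exists>j<n. e = {v, j}" if "e \<in> E" "v \<in> e" for e
    proof -
      obtain a b where "e = {a, b}" "a \<noteq> b"
        using simple_edges[OF \<open>e \<in> E\<close>] by (meson card_2_iff)
      then show ?thesis using that edge_vertices[of a b] by auto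
    qed
    then show "(\<lambda>j. {v, j}) ` {j \<in> {..<n}. {v, j} \<in> E} = {e \<in> E. v \<in> e}"
      by fastforce
  qed
  then have "vertex_degree E v = card {j \<in> {..<n}. {v, j} \<in> E}"
    by (simp add: vertex_degree_def bij_betw_same_card)
  then show ?thesis
    by (simp add: sum.If_cases Int_def)
qed

lemma laplacian_entry:
  assumes "i < n" "j < n"
  shows "laplacian n E \<sigma> $$ (i, j)
    = (if i = j then real (vertex_degree E i) else 0) - (if {i, j} \<in> E then \<sigma> {i, j} else 0)"
  using assms by (simp add: laplacian_def degree_matrix_def adjacency_matrix_def mat_diag_def)

lemma laplacian_carrier: "laplacian n E \<sigma> \<in> carrier_mat n n"
  unfolding laplacian_def by (rule minus_carrier_mat) (simp add: adjacency_matrix_def)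

lemma laplacian_symmetric:
  "i < n \<Longrightarrow> j < n \<Longrightarrow> laplacian n E \<sigma> $$ (i, j) = laplacian n E \<sigma> $$ (j, i)"
  by (simp add: laplacian_entry insert_commute)

lemma laplacian_trace: "(\<Sum>i<n. laplacian n E \<sigma> $$ (i, i)) = deg_power_sum n E 1"
proof -
  have "{i, i} \<notin> E" for i using edge_vertices by blast
  then show ?thesis by (simp add: laplacian_entry deg_power_sum_def)
qed

text \<open>Row \<open>i\<close> contributes the squared degree from the diagonal and one unit for
  each neighbour, as signs square to 1.\<close>

lemma laplacian_frobenius:
  "(\<Sum>i<n. \<Sum>j<n. (laplacian n E \<sigma> $$ (i, j))\<^sup>2) = deg_power_sum n E 1 + deg_power_sum n E 2"
proof -
  have "(\<Sum>j<n. (laplacian n E \<sigma> $$ (i, j))\<^sup>2)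
      = real (vertex_degree E i) + (real (vertex_degree E i))\<^sup>2" if "i < n" for i
  proof -
    have "(\<Sum>j<n. (laplacian n E \<sigma> $$ (i, j))\<^sup>2)
        = (\<Sum>j<n. (if i = j then (real (vertex_degree E i))\<^sup>2 else 0) + (if {i, j} \<in> E then 1 else 0))"
    proof (intro sum.cong refl)
      fix j assume "j \<in> {..<n}"
      then show "(laplacian n E \<sigma> $$ (i, j))\<^sup>2
          = (if i = j then (real (vertex_degree E i))\<^sup>2 else 0) + (if {i, j} \<in> E then 1 else 0)"
        using that edge_vertices[of i j] signature[of "{i, j}"] by (auto simp: laplacian_entry)
    qed
    then show ?thesis using that by (simp add: sum.distrib vertex_degree_eq_sum[symmetric])
  qed
  then show ?thesis by (simp add: deg_power_sum_def sum.distrib)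
qed

section \<open>Connected components and the kernel vectors of balanced ones\<close>

lemma equiv_connected_rel: "equiv {0..<n} (connected_rel n E)"
proof (rule equivI)
  have "sym {(x, y). {x, y} \<in> E}" by (auto simp: sym_def insert_commute)
  then have "sym ({(x, y). {x, y} \<in> E}\<^sup>*)" by (rule sym_rtrancl)
  then show "sym (connected_rel n E)"
    unfolding connected_rel_def sym_def by blast
  show "trans (connected_rel n E)"
    unfolding connected_rel_def trans_def by (blast intro: rtrancl_trans)
qed (auto simp: connected_rel_def refl_on_def)

lemma component_subset: "C \<in> components n E \<Longrightarrow> C \<subseteq> {..<n}"
  unfolding components_def using in_quotient_imp_subset[OF equiv_connected_rel]
  by (metis atLeast0LessThan)

lemma component_closed:
  assumes "C \<in> components n E" "u \<in> C" "{u, v} \<in> E"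
  shows "v \<in> C"
proof (rule in_quotient_imp_closed[OF equiv_connected_rel])
  show "C \<in> {0..<n} // connected_rel n E" using assms(1) by (simp add: components_def)
  have "(u, v) \<in> {(x, y). {x, y} \<in> E}\<^sup>*" using assms(3) by (simp add: r_into_rtrancl)
  then show "(u, v) \<in> connected_rel n E"
    using edge_vertices[OF assms(3)] unfolding connected_rel_def by blast
qed fact

text \<open>A walk that starts in a component never leaves it, so it runs within the induced edges;
  membership of the current endpoint is carried through the induction. Balance of a component is
  stated for exactly these edges.\<close>

lemma component_connected:
  assumes C: "C \<in> components n E" and rv: "r \<in> C" "v \<in> C"
  shows "(r, v) \<in> {(x, y). {x, y} \<in> {e \<in> E. e \<subseteq> C}}\<^sup>*"
proof -
  have "(r, v) \<in> connected_rel n E"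
    by (rule in_quotient_imp_in_rel[OF equiv_connected_rel, of C])
      (use C rv in \<open>simp_all add: components_def\<close>)
  then have "(r, v) \<in> {(x, y). {x, y} \<in> E}\<^sup>*"
    unfolding connected_rel_def by blast
  then have "(r, v) \<in> {(x, y). {x, y} \<in> {e \<in> E. e \<subseteq> C}}\<^sup>* \<and> v \<in> C"
  proof (induction rule: rtrancl_induct)
    case base
    show ?case using rv by simp
  next
    case (step y z)
    have "{y, z} \<in> E" using step.hyps(2) by simp
    have "y \<in> C" and ry: "(r, y) \<in> {(x, y). {x, y} \<in> {e \<in> E. e \<subseteq> C}}\<^sup>*"
      using conjunct2[OF step.IH] conjunct1[OF step.IH] .
    have "z \<in> C" by (rule component_closed[OF C]) fact+
    have yz: "(y, z) \<in> {(x, y). {x, y} \<in> {e \<in> E. e \<subseteq> C}}"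
      using \<open>{y, z} \<in> E\<close> \<open>y \<in> C\<close> \<open>z \<in> C\<close> by simp
    show ?case
      by (rule conjI[OF rtrancl_into_rtrancl[OF ry yz] \<open>z \<in> C\<close>])
  qed
  then show ?thesis ..
qed

text \<open>The switching function of the component, extended by zero and normalised. Extension by
  zero is harmless because no edge leaves the component.\<close>

lemma balanced_component_kernel:
  assumes C: "C \<in> components n E" and bal: "balanced {e \<in> E. e \<subseteq> C} \<sigma>"
  shows "\<exists>u. (\<forall>i. i \<notin> C \<longrightarrow> u i = 0) \<and> (\<Sum>i<n. u i * u i) = 1
    \<and> (\<forall>i<n. (\<Sum>j<n. laplacian n E \<sigma> $$ (i, j) * u j) = 0)"
proof -
  have sub: "C \<subseteq> {..<n}" by (rule component_subset[OF C])
  obtain r where "r \<in> C"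
    using in_quotient_imp_non_empty[OF equiv_connected_rel] C by (auto simp: components_def)
  then have "card C > 0"
    using sub finite_subset card_gt_0_iff by blast
  obtain \<theta> where \<theta>: "\<And>v. v \<in> C \<Longrightarrow> \<theta> v = 1 \<or> \<theta> v = -1"
    "\<And>u v. u \<in> C \<Longrightarrow> v \<in> C \<Longrightarrow> {u, v} \<in> E \<Longrightarrow> \<sigma> {u, v} = \<theta> u * \<theta> v"
  proof -
    have "\<exists>\<theta>. (\<forall>v\<in>C. \<theta> v = 1 \<or> \<theta> v = -1)
      \<and> (\<forall>u\<in>C. \<forall>v\<in>C. {u, v} \<in> {e \<in> E. e \<subseteq> C} \<longrightarrow> \<sigma> {u, v} = \<theta> u * \<theta> v)"
      by (rule balanced_switching[OF bal _ _ component_connected[OF C \<open>r \<in> C\<close>]])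
        (simp_all add: simple_edges signature)
    then show thesis using that by auto
  qed
  have \<theta>\<theta>: "\<theta> v * \<theta> v = 1" if "v \<in> C" for v
    using \<theta>(1)[OF that] by auto
  define z where "z v = (if v \<in> C then \<theta> v else 0)" for v
  have zz: "(\<Sum>i<n. z i * z i) = real (card C)"
  proof -
    have "(\<Sum>i<n. z i * z i) = (\<Sum>i<n. if i \<in> C then 1 else 0)"
      by (intro sum.cong refl) (auto simp: z_def \<theta>\<theta>)
    also have "\<dots> = real (card C)"
      using sub by (simp add: sum.If_cases inf.absorb2)
    finally show ?thesis .
  qed
  have Lz: "(\<Sum>j<n. laplacian n E \<sigma> $$ (i, j) * z j) = 0" if "i < n" for i
  proof -
    \<comment> \<open>Every neighbour of \<open>i\<close> contributes exactly \<open>z i\<close>: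
      inside \<open>C\<close> because \<open>\<theta> j * \<theta> j = 1\<close>, outside because
      both sides vanish. The adjacency part thus cancels the degree part.\<close>
    have nb: "(if {i, j} \<in> E then \<sigma> {i, j} else 0) * z j = (if {i, j} \<in> E then 1 else 0) * z i" for j
    proof (cases "{i, j} \<in> E")
      case True
      then have "j \<in> C \<longleftrightarrow> i \<in> C"
        using component_closed[OF C] by (metis insert_commute)
      then show ?thesis using True \<theta>(1)[of i] \<theta>(1)[of j] \<theta>(2)[of i j] by (auto simp: z_def)
    qed simp
    have "(\<Sum>j<n. laplacian n E \<sigma> $$ (i, j) * z j)
        = (\<Sum>j<n. (if i = j then real (vertex_degree E i) * z i else 0)
            - (if {i, j} \<in> E then 1 else 0) * z i)"
      by (intro sum.cong refl) (use that in \<open>simp add: laplacian_entry left_diff_distrib nb del: mult_1 mult_zero_left\<close>)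
    then show ?thesis
      using that by (simp add: sum_subtractf vertex_degree_eq_sum sum_distrib_right)
  qed
  define u where "u v = z v / sqrt (real (card C))" for v
  have "(\<Sum>i<n. u i * u i) = (\<Sum>i<n. z i * z i) / real (card C)"
    by (simp add: u_def sum_divide_distrib)
  then have "(\<Sum>i<n. u i * u i) = 1"
    using \<open>card C > 0\<close> by (simp only: zz) simp
  moreover have "(\<Sum>j<n. laplacian n E \<sigma> $$ (i, j) * u j) = 0" if "i < n" for i
    using Lz[OF that] by (simp add: u_def sum_divide_distrib[symmetric])
  moreover have "u i = 0" if "i \<notin> C" for i
    using that by (simp add: u_def z_def)
  ultimately show ?thesis by blast
qed

end

section \<open>The bound on the largest Laplacian eigenvalue\<close>

theorem theorem3p2:
  fixes n :: nat and E :: "nat set set" and \<sigma> :: "nat set \<Rightarrow> real"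
  assumes "signed_graph n E \<sigma>" and "E \<noteq> {}"
  defines "s \<equiv> deg_power_sum n E"
    and "r \<equiv> real n - real (num_balanced_components n E \<sigma>)"
  shows "lambda_max (laplacian n E \<sigma>)
           \<le> s 1 / r + sqrt ((s 1 + s 2) - (s 1 + s 2 + (s 1)\<^sup>2) / r + (s 1 / r)\<^sup>2)"
proof -
  interpret signed_graph n E \<sigma> by fact
  define L where "L = laplacian n E \<sigma>"
  define \<mu> where "\<mu> = lambda_max L"
  define K where "K = {C \<in> components n E. balanced {e \<in> E. e \<subseteq> C} \<sigma>}"
  have L: "L \<in> carrier_mat n n" unfolding L_def by (rule laplacian_carrier)
  obtain e where "e \<in> E" using \<open>E \<noteq> {}\<close> by blast
  then obtain a b where ab: "{a, b} \<in> E"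
    using simple_edges by (metis card_2_iff)
  then have a: "a < n" using edge_vertices by blast
  \<comment> \<open>\<open>Max\<close> is known to be attained only on a finite nonempty set; the
    endpoint \<open>a\<close> of an edge provides \<open>n > 0\<close>.\<close>
  have "spectrum L \<noteq> {}"
    by (rule symmetric_spectrum_nonempty[OF L]) (use a laplacian_symmetric in \<open>auto simp: L_def\<close>)
  then have "\<mu> \<in> spectrum L"
    unfolding \<mu>_def lambda_max_def using card_finite_spectrum(1)[OF L] by (rule Max_in[rotated])
  then obtain v where v: "v \<in> carrier_vec n" "v \<noteq> 0\<^sub>v n" "L *\<^sub>v v = \<mu> \<cdot>\<^sub>v v"
    using L by (auto simp: spectrum_def eigenvalue_def eigenvector_def)
  have "\<forall>C\<in>K. \<exists>u. (\<forall>i. i \<notin> C \<longrightarrow> u i = 0) \<and> (\<Sum>i<n. u i * u i) = 1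
      \<and> (\<forall>i<n. (\<Sum>j<n. L $$ (i, j) * u j) = 0)"
    unfolding L_def by (rule ballI, rule balanced_component_kernel) (simp_all add: K_def)
  \<comment> \<open>The family is indexed by the balanced components themselves, so its size is
    their number.\<close>
  from bchoice[OF this] obtain w where w: "\<forall>C\<in>K. (\<forall>i. i \<notin> C \<longrightarrow> w C i = 0)
      \<and> (\<Sum>i<n. w C i * w C i) = 1 \<and> (\<forall>i<n. (\<Sum>j<n. L $$ (i, j) * w C j) = 0)"
    by (rule exE)
  have "\<mu> \<le> s 1 / r + sqrt ((s 1 + s 2) - (s 1 + s 2 + (s 1)\<^sup>2) / r + (s 1 / r)\<^sup>2)"
  proof (rule eigenvalue_le_trace_frobenius[where B = "\<lambda>i j. L $$ (i, j)" and w = w and K = K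
        and x = "\<lambda>i. v $ i" and n = n])
    show "finite K"
    proof -
      have "finite (components n E)"
        unfolding components_def by (rule finite_quotient) (auto simp: connected_rel_def)
      then show ?thesis by (simp add: K_def)
    qed
    show "(\<Sum>i<n. w C i * w D i) = (if C = D then 1 else 0)" if "C \<in> K" "D \<in> K" for C D
    proof (cases "C = D")
      case False
      \<comment> \<open>Distinct components are disjoint, so their vectors have disjoint
        supports.\<close>
      then have "C \<inter> D = {}"
        using quotient_disj[OF equiv_connected_rel, of C D] that by (auto simp: K_def components_def)
      then have "w C i = 0 \<or> w D i = 0" for i
        using bspec[OF w \<open>C \<in> K\<close>] bspec[OF w \<open>D \<in> K\<close>] by blast
      then have "w C i * w D i = 0" for i
        by simp
      then show ?thesis using False by simp
    qed (use w that in simp)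
    show "(\<Sum>j<n. L $$ (i, j) * v $ j) = \<mu> * v $ i" if "i < n" for i
    proof -
      have "(L *\<^sub>v v) $ i = (\<Sum>j<n. L $$ (i, j) * v $ j)"
        using that L v(1) by (simp add: scalar_prod_def atLeast0LessThan)
      then show ?thesis using that v by simp
    qed
    show "\<exists>i<n. v $ i \<noteq> 0"
      using v(1,2) by (metis carrier_vecD eq_vecI index_zero_vec)
    \<comment> \<open>The assumed edge enters here: it makes the trace positive, from which
      \<open>r > 0\<close> was derived.\<close>
    have "real (vertex_degree E a) > 0"
      unfolding vertex_degree_eq_sum by (rule sum_pos2[of _ b]) (use ab edge_vertices in auto)
    then show "s 1 > 0"
      unfolding s_def deg_power_sum_def by (intro sum_pos2[of _ a]) (use a in auto)
    show "(\<Sum>j<n. L $$ (i, j) * w C j) = 0" if "C \<in> K" "i < n" for C i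
      using w that by simp
    show "r = real n - real (card K)"
      by (simp add: r_def K_def num_balanced_components_def)
  qed (simp_all only: L_def s_def laplacian_symmetric laplacian_trace laplacian_frobenius)
  then show ?thesis by (simp add: \<mu>_def L_def)
qed

end
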